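(* Let $\mathcal L$ be a finite relational signature, $\mathscr D$ a nonprincipal ultrafilter over $\omega$, $(\mathcal M_t)_{t\in\omega}$ a $\mathscr D$-trending sequence of finite $\mathcal L$-structures, and $\mathfrak M^*=\prod_{t\in\omega}\mathcal M_t/\mathscr D$. Let $\mathfrak N$ be an $\mathcal L$-structure of cardinality at most $\aleph_1$ such that $\mathcal K:=\mathrm{age}(\mathfrak N)\subseteq\bigcup\{\mathrm{age}(\mathcal M_t):t\in\omega\}$. Let $\mathcal A\in\mathcal K$ have finite small Ramsey degree $d=d(\mathcal A,\mathcal K)$ in $\mathcal K$. Then for every $k\in\omega$, $\mathfrak M^*\longrightarrow_{\mathrm{int}}(\mathfrak N)^{\mathcal A}_{k,d}$.
   Context: $\mathrm{age}(\mathfrak N)$: class of finite structures embeddable in $\mathfrak N$. $\mathscr D$-trending: (1) $|M_s|\le|M_t|$ for $s<t$; (2) $|M_t|\to\infty$; (3) $\{t:\mathcal M_i\hookrightarrow\mathcal M_t\}\in\mathscr D$ for each $i$. $\binom{\mathfrak N}{\mathfrak M}$: set of substructures of $\mathfrak N$ isomorphic to $\mathfrak M$. $\mathcal C\longrightarrow(\mathcal B)^{\mathcal A}_{k,\ell}$ means: for every $c:\binom{\mathcal C}{\mathcal A}\to k$ there is a copy $\mathcal B'$ of $\mathcal B$ in $\mathcal C$ with $|c''\binom{\mathcal B'}{\mathcal A}|\le\ell$. $\mathcal A$ has finite small Ramsey degree in $\mathcal K$ if some $\ell\in\omega$ satisfies: for all $k$ and $\mathcal B\in\mathcal K$ there is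 $\mathcal C\in\mathcal K$ with $\mathcal C\longrightarrow(\mathcal B)^{\mathcal A}_{k,\ell}$; the least such $\ell$ is $d(\mathcal A,\mathcal K)$. Internal colorings: for a substructure $\mathcal A'$ of $\mathfrak M^*$, $\mathcal A'[t]$ is the substructure of $\mathcal M_t$ on $\{a[t]:a\in A'\}$; a $k$-coloring $c^*$ of copies of $\mathcal A$ in $\mathfrak M^*$ is internal if there exist $Z\in\mathscr D$ and $k$-colorings $c_t$ of copies of $\mathcal A$ in $\mathcal M_t$ ($t\in Z$) such that $c^*(\mathcal A')=j$ iff $\{t\in Z:\mathcal A'[t]\cong\mathcal A',\ c_t(\mathcal A'[t])=j\}\in\mathscr D$. $\mathfrak M^*\longrightarrow_{\mathrm{int}}(\mathfrak N)^{\mathcal A}_{k,\ell}$ means: for every internal $k$-coloring $c$ of copies of $\mathcal A$ in $\mathfrak M^*$ there is a copy $\mathfrak N'$ of $\mathfrak N$ in $\mathfrak M^*$ with $c$ taking at most $\ell$ values on $\binom{\mathfrak N'}{\mathcal A}$. *)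

theory Defs
  imports Main
begin

record ('a, 'r) struc =
  carr :: "'a set"
  rels :: "'r \<Rightarrow> 'a list \<Rightarrow> bool"

definition is_struc :: "'r set \<Rightarrow> ('r \<Rightarrow> nat) \<Rightarrow> ('a, 'r) struc \<Rightarrow> bool" where
  "is_struc L ar S \<longleftrightarrow>
     (\<forall>R xs. rels S R xs \<longrightarrow> R \<in> L \<and> length xs = ar R \<and> set xs \<subseteq> carr S)"

definition preserves :: "'r set \<Rightarrow> ('r \<Rightarrow> nat) \<Rightarrow> ('a, 'r) struc \<Rightarrow> ('b, 'r) struc \<Rightarrow> ('a \<Rightarrow> 'b) \<Rightarrow> bool" where
  "preserves L ar A B h \<longleftrightarrow>
     (\<forall>R\<in>L. \<forall>xs. length xs = ar R \<and> set xs \<subseteq> carr A \<longrightarrow>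
        (rels A R xs \<longleftrightarrow> rels B R (map h xs)))"

definition embedding :: "'r set \<Rightarrow> ('r \<Rightarrow> nat) \<Rightarrow> ('a, 'r) struc \<Rightarrow> ('b, 'r) struc \<Rightarrow> ('a \<Rightarrow> 'b) \<Rightarrow> bool" where
  "embedding L ar A B h \<longleftrightarrow> inj_on h (carr A) \<and> h ` carr A \<subseteq> carr B \<and> preserves L ar A B h"

definition embeds :: "'r set \<Rightarrow> ('r \<Rightarrow> nat) \<Rightarrow> ('a, 'r) struc \<Rightarrow> ('b, 'r) struc \<Rightarrow> bool" where
  "embeds L ar A B \<longleftrightarrow> (\<exists>h. embedding L ar A B h)"

definition isomorphic :: "'r set \<Rightarrow> ('r \<Rightarrow> nat) \<Rightarrow> ('a, 'r) struc \<Rightarrow> ('b, 'r) struc \<Rightarrow> bool" where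
  "isomorphic L ar A B \<longleftrightarrow> (\<exists>h. bij_betw h (carr A) (carr B) \<and> preserves L ar A B h)"

definition induced :: "('a, 'r) struc \<Rightarrow> 'a set \<Rightarrow> ('a, 'r) struc" where
  "induced S X = \<lparr> carr = X, rels = (\<lambda>R xs. rels S R xs \<and> set xs \<subseteq> X) \<rparr>"

text \<open>copies S A = binom(S, A): substructures of S isomorphic to A, identified with
their (induced) carriers.\<close>

definition copies :: "'r set \<Rightarrow> ('r \<Rightarrow> nat) \<Rightarrow> ('a, 'r) struc \<Rightarrow> ('b, 'r) struc \<Rightarrow> 'a set set" where
  "copies L ar S A = {X. X \<subseteq> carr S \<and> isomorphic L ar (induced S X) A}"

text \<open>Age: finite L-structures embeddable in N.  Since every finite structure is
isomorphic to one whose elements are natural numbers, we represent the class by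
structures on nat.\<close>

definition age :: "'r set \<Rightarrow> ('r \<Rightarrow> nat) \<Rightarrow> ('a, 'r) struc \<Rightarrow> (nat, 'r) struc set" where
  "age L ar N = {B. is_struc L ar B \<and> finite (carr B) \<and> embeds L ar B N}"

definition arrow :: "'r set \<Rightarrow> ('r \<Rightarrow> nat) \<Rightarrow> ('c, 'r) struc \<Rightarrow> ('b, 'r) struc \<Rightarrow> ('a, 'r) struc
                     \<Rightarrow> nat \<Rightarrow> nat \<Rightarrow> bool" where
  "arrow L ar C B A k l \<longleftrightarrow>
     (\<forall>c :: 'c set \<Rightarrow> nat. (\<forall>X\<in>copies L ar C A. c X < k) \<longrightarrow>
        (\<exists>Y\<in>copies L ar C B. card (c ` copies L ar (induced C Y) A) \<le> l))"

definition ramsey_bound :: "'r set \<Rightarrow> ('r \<Rightarrow> nat) \<Rightarrow> (nat, 'r) struc set \<Rightarrow> (nat, 'r) struc \<Rightarrow> nat \<Rightarrow> bool" where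
  "ramsey_bound L ar K A l \<longleftrightarrow>
     (\<forall>k B. B \<in> K \<longrightarrow> (\<exists>C\<in>K. arrow L ar C B A k l))"

definition finite_small_ramsey_degree :: "'r set \<Rightarrow> ('r \<Rightarrow> nat) \<Rightarrow> (nat, 'r) struc set \<Rightarrow> (nat, 'r) struc \<Rightarrow> bool" where
  "finite_small_ramsey_degree L ar K A \<longleftrightarrow> (\<exists>l. ramsey_bound L ar K A l)"

definition small_ramsey_degree :: "'r set \<Rightarrow> ('r \<Rightarrow> nat) \<Rightarrow> (nat, 'r) struc set \<Rightarrow> (nat, 'r) struc \<Rightarrow> nat" where
  "small_ramsey_degree L ar K A = (LEAST l. ramsey_bound L ar K A l)"

definition card_le_aleph1 :: "'a set \<Rightarrow> bool" where
  "card_le_aleph1 X \<longleftrightarrow> (card_of X, cardSuc natLeq) \<in> ordLeq"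

definition ultrafilter_on_nat :: "nat set set \<Rightarrow> bool" where
  "ultrafilter_on_nat D \<longleftrightarrow>
     UNIV \<in> D \<and> {} \<notin> D \<and>
     (\<forall>X Y. X \<in> D \<and> X \<subseteq> Y \<longrightarrow> Y \<in> D) \<and>
     (\<forall>X Y. X \<in> D \<and> Y \<in> D \<longrightarrow> X \<inter> Y \<in> D) \<and>
     (\<forall>X. X \<in> D \<or> - X \<in> D)"

definition nonprincipal :: "nat set set \<Rightarrow> bool" where
  "nonprincipal D \<longleftrightarrow> (\<forall>X\<in>D. infinite X)"

definition uclass :: "nat set set \<Rightarrow> (nat \<Rightarrow> 'm) \<Rightarrow> (nat \<Rightarrow> 'm) set" where
  "uclass D f = {g. {t. g t = f t} \<in> D}"

definition rep :: "(nat \<Rightarrow> 'm) set \<Rightarrow> nat \<Rightarrow> 'm" where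
  "rep a = (SOME f. f \<in> a)"

definition ultraproduct :: "nat set set \<Rightarrow> (nat \<Rightarrow> ('m, 'r) struc) \<Rightarrow> ((nat \<Rightarrow> 'm) set, 'r) struc" where
  "ultraproduct D M =
     (let U = {uclass D f | f. {t. f t \<in> carr (M t)} \<in> D}
      in \<lparr> carr = U,
           rels = (\<lambda>R as. set as \<subseteq> U \<and> {t. rels (M t) R (map (\<lambda>a. rep a t) as)} \<in> D) \<rparr>)"

definition trending :: "'r set \<Rightarrow> ('r \<Rightarrow> nat) \<Rightarrow> nat set set \<Rightarrow> (nat \<Rightarrow> ('m, 'r) struc) \<Rightarrow> bool" where
  "trending L ar D M \<longleftrightarrow>
     (\<forall>s t. s < t \<longrightarrow> card (carr (M s)) \<le> card (carr (M t))) \<and>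
     filterlim (\<lambda>t. card (carr (M t))) at_top sequentially \<and>
     (\<forall>i. {t. embeds L ar (M i) (M t)} \<in> D)"

definition slice :: "(nat \<Rightarrow> 'm) set set \<Rightarrow> nat \<Rightarrow> 'm set" where
  "slice X t = (\<lambda>a. rep a t) ` X"

definition internal_colouring ::
  "'r set \<Rightarrow> ('r \<Rightarrow> nat) \<Rightarrow> nat set set \<Rightarrow> (nat \<Rightarrow> ('m, 'r) struc) \<Rightarrow> ('a, 'r) struc \<Rightarrow> nat
    \<Rightarrow> ((nat \<Rightarrow> 'm) set set \<Rightarrow> nat) \<Rightarrow> bool" where
  "internal_colouring L ar D M A k c \<longleftrightarrow>
     (let Ms = ultraproduct D M in
      (\<forall>X\<in>copies L ar Ms A. c X < k) \<and>
      (\<exists>Z\<in>D. \<exists>ct :: nat \<Rightarrow> 'm set \<Rightarrow> nat.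
         (\<forall>t\<in>Z. \<forall>Y\<in>copies L ar (M t) A. ct t Y < k) \<and>
         (\<forall>X\<in>copies L ar Ms A. \<forall>j.
            c X = j \<longleftrightarrow>
            {t\<in>Z. isomorphic L ar (induced (M t) (slice X t)) (induced Ms X)
                  \<and> ct t (slice X t) = j} \<in> D)))"

definition int_arrow ::
  "'r set \<Rightarrow> ('r \<Rightarrow> nat) \<Rightarrow> nat set set \<Rightarrow> (nat \<Rightarrow> ('m, 'r) struc) \<Rightarrow> ('n, 'r) struc
    \<Rightarrow> ('a, 'r) struc \<Rightarrow> nat \<Rightarrow> nat \<Rightarrow> bool" where
  "int_arrow L ar D M N A k l \<longleftrightarrow>
     (\<forall>c. internal_colouring L ar D M A k c \<longrightarrow>
        (\<exists>Y\<in>copies L ar (ultraproduct D M) N.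
           card (c ` copies L ar (induced (ultraproduct D M) Y) A) \<le> l))"

end

theory Submission
  imports Defs "HOL-Library.Countable_Set_Type"
begin

text \<open>
  Ramsey's property in the age, pigeonhole over the finitely many sets of at most \<open>d\<close> colours, and
  directedness of the finite subsets of \<open>N\<close> give one set \<open>S\<close> of at most \<open>d\<close> colours such that each
  finite \<open>F \<subseteq> N\<close> embeds into \<open>M t\<close>, for \<open>D\<close>-many \<open>t\<close>, with all copies of \<open>A\<close> in the image coloured
  from \<open>S\<close>. Well-order \<open>N\<close> so that initial segments are countable and choose the image of each point
  by transfinite recursion, keeping the invariant that the part of the map already defined extends,
  for every finite \<open>F \<subseteq> N\<close> and \<open>D\<close>-many \<open>t\<close>, to such an embedding of \<open>F\<close>. Since the signature is
  finite, a countable set has only countably many isomorphism types of finite sets over it, so each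
  step realises countably many conditions and countable saturation suffices.
\<close>

section \<open>Ultrafilters and countable saturation\<close>

definition ultrafilter :: "'a filter \<Rightarrow> bool" where
  "ultrafilter U \<longleftrightarrow> U \<noteq> bot \<and> (\<forall>P. eventually P U \<or> eventually (\<lambda>x. \<not> P x) U)"

lemma ultrafilter_frequently_iff_eventually:
  assumes "ultrafilter U"
  shows "(\<exists>\<^sub>F t in U. P t) \<longleftrightarrow> (\<forall>\<^sub>F t in U. P t)"
  using assms eventually_frequently unfolding ultrafilter_def frequently_def by blast

lemma ultrafilter_eventually_bex_finite:
  assumes "ultrafilter U" "finite I" "\<forall>\<^sub>F t in U. \<exists>i\<in>I. P t i"
  shows "\<exists>i\<in>I. \<forall>\<^sub>F t in U. P t i"
  using assms frequently_bex_finite[of I P U]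
  by (simp add: ultrafilter_frequently_iff_eventually)

definition filter_of :: "'a set set \<Rightarrow> 'a filter" where
  "filter_of D = Abs_filter (\<lambda>P. Collect P \<in> D)"

lemma eventually_filter_of:
  assumes "ultrafilter_on_nat D"
  shows "eventually P (filter_of D) \<longleftrightarrow> {t. P t} \<in> D"
  unfolding filter_of_def
proof (rule eventually_Abs_filter, unfold_locales)
  show "{t. True} \<in> D" using assms by (simp add: ultrafilter_on_nat_def)
next
  fix P Q assume "{t. P t} \<in> D" "{t. Q t} \<in> D"
  then show "{t. P t \<and> Q t} \<in> D"
    using assms unfolding ultrafilter_on_nat_def Collect_conj_eq by blast
next
  fix P Q assume "\<forall>t. P t \<longrightarrow> Q t" "{t. P t} \<in> D"
  then show "{t. Q t} \<in> D"
    using assms unfolding ultrafilter_on_nat_def by (meson Collect_mono)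
qed

lemma ultrafilter_filter_of:
  assumes "ultrafilter_on_nat D"
  shows "ultrafilter (filter_of D)"
proof -
  have "{t. P t} \<in> D \<or> {t. \<not> P t} \<in> D" for P
    using assms unfolding ultrafilter_on_nat_def Collect_neg_eq by blast
  moreover have "filter_of D \<noteq> bot"
    unfolding eventually_False[symmetric] eventually_filter_of[OF assms]
    using assms by (simp add: ultrafilter_on_nat_def)
  ultimately show ?thesis
    unfolding ultrafilter_def eventually_filter_of[OF assms] by blast
qed

lemma filter_of_le_sequentially:
  assumes ultra: "ultrafilter_on_nat D" and "nonprincipal D"
  shows "filter_of D \<le> sequentially"
  unfolding le_sequentially eventually_filter_of[OF ultra]
proof
  fix n
  have "{..<n} \<notin> D" using assms(2) unfolding nonprincipal_def by auto
  then have "- {..<n} \<in> D" using ultra unfolding ultrafilter_on_nat_def by blast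
  then show "{t. n \<le> t} \<in> D" by (simp add: Compl_lessThan atLeast_def)
qed

lemma countable_saturation:
  assumes "U \<le> sequentially" "countable I"
    and sat: "\<And>J. J \<in> Fpow I \<Longrightarrow> \<forall>\<^sub>F t in U. \<exists>x. \<forall>i\<in>J. \<phi> i t x"
  shows "\<exists>x. \<forall>i\<in>I. \<forall>\<^sub>F t in U. \<phi> i t (x t)"
proof -
  define J where "J n = to_nat_on I -` {..<n} \<inter> I" for n
  define satisfiable where "satisfiable t n \<longleftrightarrow> n \<le> t \<and> (\<exists>x. \<forall>i\<in>J n. \<phi> i t x)" for t n
  define depth where "depth t = (GREATEST n. satisfiable t n)" for t
  have bounded: "n \<le> t" if "satisfiable t n" for t n
    using that unfolding satisfiable_def by blast
  have "satisfiable t 0" for t unfolding satisfiable_def J_def by simp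
  then have "satisfiable t (depth t)" for t
    unfolding depth_def using bounded by (rule GreatestI_nat)
  then obtain x where x: "\<And>t i. i \<in> J (depth t) \<Longrightarrow> \<phi> i t (x t)"
    unfolding satisfiable_def by metis
  have "\<forall>\<^sub>F t in U. \<phi> i t (x t)" if "i \<in> I" for i
  proof -
    define n where "n = Suc (to_nat_on I i)"
    have "J n \<in> Fpow I"
      unfolding J_def Fpow_def using assms(2) by (auto intro: finite_vimage_IntI)
    then have "\<forall>\<^sub>F t in U. \<exists>x. \<forall>i\<in>J n. \<phi> i t x" by (rule sat)
    moreover have "\<forall>\<^sub>F t in U. n \<le> t" using assms(1) unfolding le_sequentially by blast
    ultimately show ?thesis
    proof eventually_elim
      case (elim t)
      then have "n \<le> depth t"
        unfolding depth_def satisfiable_def by (intro Greatest_le_nat[where b = t]) auto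
      then have "i \<in> J (depth t)" using that by (simp add: J_def n_def)
      then show ?case by (rule x)
    qed
  qed
  then show ?thesis by blast
qed

section \<open>Embeddings and copies\<close>

lemma carr_induced [simp]: "carr (induced S X) = X"
  by (simp add: induced_def)

lemma rels_induced [simp]: "rels (induced S X) R xs \<longleftrightarrow> rels S R xs \<and> set xs \<subseteq> X"
  by (simp add: induced_def)

lemma induced_induced [simp]: "X \<subseteq> Y \<Longrightarrow> induced (induced S Y) X = induced S X"
  by (auto simp: induced_def fun_eq_iff)

lemma is_struc_induced: "is_struc L ar S \<Longrightarrow> is_struc L ar (induced S X)"
  by (auto simp: is_struc_def)

lemma preserves_comp:
  assumes "preserves L ar A B g" "g ` carr A \<subseteq> carr B" "preserves L ar B C h"
  shows "preserves L ar A C (h \<circ> g)"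
  unfolding preserves_def
proof (intro ballI allI impI)
  fix R xs assume R: "R \<in> L" and xs: "length xs = ar R \<and> set xs \<subseteq> carr A"
  have "rels A R xs \<longleftrightarrow> rels B R (map g xs)"
    using assms(1) R xs unfolding preserves_def by blast
  also have "length (map g xs) = ar R \<and> set (map g xs) \<subseteq> carr B"
    using assms(2) xs by auto
  then have "rels B R (map g xs) \<longleftrightarrow> rels C R (map h (map g xs))"
    using assms(3) R unfolding preserves_def by blast
  finally show "rels A R xs \<longleftrightarrow> rels C R (map (h \<circ> g) xs)" by simp
qed

lemma preserves_inv_into:
  assumes bij: "bij_betw h (carr A) (carr B)" and "preserves L ar A B h"
  shows "preserves L ar B A (inv_into (carr A) h)"
  unfolding preserves_def
proof (intro ballI allI impI)
  let ?g = "inv_into (carr A) h"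
  fix R xs assume R: "R \<in> L" and xs: "length xs = ar R \<and> set xs \<subseteq> carr B"
  have "set (map ?g xs) \<subseteq> carr A"
    using xs bij_betw_inv_into[OF bij] by (auto simp: bij_betw_def)
  then have "rels A R (map ?g xs) \<longleftrightarrow> rels B R (map h (map ?g xs))"
    using assms(2) R xs unfolding preserves_def by simp
  moreover have "map h (map ?g xs) = xs"
    unfolding map_map using xs bij by (intro map_idI) (auto simp: bij_betw_inv_into_right)
  ultimately show "rels B R xs \<longleftrightarrow> rels A R (map ?g xs)" by simp
qed

lemma embedding_comp:
  assumes "embedding L ar A B g" "embedding L ar B C h"
  shows "embedding L ar A C (h \<circ> g)"
  using assms preserves_comp[of L ar A B g C h] unfolding embedding_def
  by (auto intro: comp_inj_on inj_on_subset)

lemma embedding_cong: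
  assumes "embedding L ar A B g" "\<And>x. x \<in> carr A \<Longrightarrow> g x = h x"
  shows "embedding L ar A B h"
proof -
  have "map h xs = map g xs" if "set xs \<subseteq> carr A" for xs
    using assms(2) that by auto
  then have "preserves L ar A B h"
    using assms(1) unfolding embedding_def preserves_def by metis
  moreover have "g ` carr A = h ` carr A" using assms(2) by (rule image_cong[OF refl])
  moreover have "inj_on g (carr A) = inj_on h (carr A)" using assms(2) by (rule inj_on_cong)
  ultimately show ?thesis using assms(1) unfolding embedding_def by simp
qed

lemma embedding_inclusion: "X \<subseteq> carr S \<Longrightarrow> embedding L ar (induced S X) S id"
  unfolding embedding_def preserves_def by auto

lemma embedding_induced_mono: "X \<subseteq> Y \<Longrightarrow> embedding L ar (induced S X) (induced S Y) id"
  using embedding_inclusion[of X "induced S Y"] by simp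

lemma embedding_induced_codomain:
  assumes "embedding L ar A B h" "h ` carr A \<subseteq> Y"
  shows "embedding L ar A (induced B Y) h"
proof -
  have "set (map h xs) \<subseteq> Y" if "set xs \<subseteq> carr A" for xs
    using assms(2) that by auto
  then show ?thesis using assms unfolding embedding_def preserves_def by simp
qed

lemma embedding_inv_into:
  assumes "embedding L ar A B h" "h ` carr A = carr B"
  shows "embedding L ar B A (inv_into (carr A) h)"
  using assms preserves_inv_into[of h A B] bij_betw_inv_into[of h "carr A" "carr B"]
  unfolding embedding_def bij_betw_def by simp

lemma isomorphic_iff_embedding:
  "isomorphic L ar A B \<longleftrightarrow> (\<exists>h. embedding L ar A B h \<and> h ` carr A = carr B)"
  unfolding isomorphic_def embedding_def bij_betw_def by auto

lemma isomorphic_trans: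
  assumes "isomorphic L ar A B" "isomorphic L ar B C"
  shows "isomorphic L ar A C"
proof -
  obtain g h where "embedding L ar A B g" "g ` carr A = carr B"
    "embedding L ar B C h" "h ` carr B = carr C"
    using assms unfolding isomorphic_iff_embedding by blast
  then have "embedding L ar A C (h \<circ> g)" "(h \<circ> g) ` carr A = carr C"
    by (simp_all only: embedding_comp image_comp[symmetric])
  then show ?thesis unfolding isomorphic_iff_embedding by blast
qed

lemma isomorphic_sym: "isomorphic L ar A B \<Longrightarrow> isomorphic L ar B A"
  unfolding isomorphic_def using preserves_inv_into bij_betw_inv_into by blast

lemma isomorphic_embedding_image:
  assumes "embedding L ar A B h"
  shows "isomorphic L ar A (induced B (h ` carr A))"
  unfolding isomorphic_iff_embedding
  using embedding_induced_codomain[OF assms order.refl] by (metis carr_induced)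

lemma embedding_image_in_copies:
  assumes "embedding L ar A B h"
  shows "h ` carr A \<in> copies L ar B A"
  using assms isomorphic_sym[OF isomorphic_embedding_image[OF assms]]
  unfolding copies_def embedding_def by blast

lemma image_in_copies_iff:
  assumes emb: "embedding L ar P T h" and subset: "X \<subseteq> carr P"
  shows "h ` X \<in> copies L ar T A \<longleftrightarrow> X \<in> copies L ar P A"
proof -
  have "embedding L ar (induced P X) T h"
    using embedding_comp[OF embedding_inclusion[OF subset] emb] by simp
  from isomorphic_embedding_image[OF this]
  have "isomorphic L ar (induced P X) (induced T (h ` X))" by simp
  moreover have "h ` X \<subseteq> carr T" using emb subset unfolding embedding_def by blast
  ultimately show ?thesis
    unfolding copies_def using subset by (auto intro: isomorphic_trans isomorphic_sym)
qed

lemma copies_induced: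
  assumes "Y \<subseteq> carr S"
  shows "copies L ar (induced S Y) A = {X \<in> copies L ar S A. X \<subseteq> Y}"
  using assms unfolding copies_def by auto

lemma copies_induced_embedding_image:
  assumes emb: "embedding L ar P T h"
  shows "copies L ar (induced T (h ` carr P)) A = (`) h ` copies L ar P A"
proof -
  have "copies L ar (induced T (h ` carr P)) A = {X \<in> copies L ar T A. X \<subseteq> h ` carr P}"
    using emb by (intro copies_induced) (simp add: embedding_def)
  also have "\<dots> = (`) h ` {X. X \<subseteq> carr P \<and> h ` X \<in> copies L ar T A}"
    by (auto elim: subset_imageE)
  also have "{X. X \<subseteq> carr P \<and> h ` X \<in> copies L ar T A} = copies L ar P A"
    using image_in_copies_iff[OF emb, where A = A] by (auto simp: copies_def)
  finally show ?thesis .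
qed

lemma in_copies_imp_subset: "X \<in> copies L ar S A \<Longrightarrow> X \<subseteq> carr S"
  by (simp add: copies_def)

lemma in_copies_imp_finite: "X \<in> copies L ar S A \<Longrightarrow> finite (carr A) \<Longrightarrow> finite X"
  unfolding copies_def isomorphic_def by (auto dest: bij_betw_finite)

section \<open>Countably many finite structures\<close>

definition image_struc :: "('a \<Rightarrow> 'b) \<Rightarrow> ('a, 'r) struc \<Rightarrow> ('b, 'r) struc" where
  "image_struc g S = \<lparr>carr = g ` carr S,
     rels = (\<lambda>R ys. \<exists>xs. set xs \<subseteq> carr S \<and> ys = map g xs \<and> rels S R xs)\<rparr>"

lemma carr_image_struc [simp]: "carr (image_struc g S) = g ` carr S"
  by (simp add: image_struc_def)

lemma is_struc_image_struc: "is_struc L ar S \<Longrightarrow> is_struc L ar (image_struc g S)"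
  unfolding is_struc_def image_struc_def by fastforce

lemma embedding_image_struc:
  assumes inj: "inj_on g (carr S)"
  shows "embedding L ar S (image_struc g S) g"
proof -
  have "rels S R xs \<longleftrightarrow> rels (image_struc g S) R (map g xs)" if xs: "set xs \<subseteq> carr S" for R xs
  proof -
    have "ys = xs" if "map g xs = map g ys" "set ys \<subseteq> carr S" for ys
      using that xs inj by (metis Un_least inj_on_map_eq_map inj_on_subset)
    then show ?thesis using xs by (auto simp: image_struc_def)
  qed
  then show ?thesis using inj unfolding embedding_def preserves_def by simp
qed

lemma image_struc_eq_imp_embedding:
  assumes "image_struc f A = image_struc g B" "inj_on f (carr A)" "inj_on g (carr B)"
  shows "embedding L ar A B (inv_into (carr B) g \<circ> f)"
proof (rule embedding_comp)
  show "embedding L ar A (image_struc g B) f"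
    using embedding_image_struc[OF assms(2)] assms(1) by simp
  show "embedding L ar (image_struc g B) B (inv_into (carr B) g)"
    using embedding_image_struc[OF assms(3)] by (rule embedding_inv_into) simp
qed

lemma age_contains_finite_substructures:
  assumes "is_struc L ar N" "F \<in> Fpow (carr N)"
  shows "\<exists>B\<in>age L ar N. isomorphic L ar (induced N F) B"
proof
  let ?B = "image_struc (to_nat_on F) (induced N F)"
  have fin: "finite F" and subset: "F \<subseteq> carr N" using assms(2) by (auto simp: Fpow_def)
  have emb: "embedding L ar (induced N F) ?B (to_nat_on F)"
    using fin by (intro embedding_image_struc) (simp add: inj_on_to_nat_on countable_finite)
  from isomorphic_embedding_image[OF this] emb show "isomorphic L ar (induced N F) ?B"
    unfolding isomorphic_iff_embedding by auto
  have "embedding L ar ?B (induced N F) (inv_into F (to_nat_on F))"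
    using embedding_inv_into[OF emb] by simp
  from embedding_comp[OF this embedding_inclusion[OF subset]] show "?B \<in> age L ar N"
    using fin assms(1) unfolding age_def embeds_def
    by (auto intro: is_struc_image_struc is_struc_induced)
qed

lemma countable_finite_strucs:
  fixes X :: "'a set" and L :: "'r set"
  assumes "finite L" "countable X"
  shows "countable {S :: ('a, 'r) struc. is_struc L ar S \<and> finite (carr S) \<and> carr S \<subseteq> X}"
    (is "countable ?\<S>")
proof (rule countable_image_inj_on)
  let ?graph = "\<lambda>S :: ('a, 'r) struc. {(R, xs). rels S R xs}"
  have "?graph S \<in> Fpow (L \<times> lists X)" if "S \<in> ?\<S>" for S
  proof -
    have S: "is_struc L ar S" "finite (carr S)" "carr S \<subseteq> X" using that by auto
    then have "?graph S \<subseteq> (\<Union>R\<in>L. {R} \<times> {xs. set xs \<subseteq> carr S \<and> length xs = ar R})"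
      unfolding is_struc_def by blast
    moreover have "finite (\<Union>R\<in>L. {R} \<times> {xs. set xs \<subseteq> carr S \<and> length xs = ar R})"
      using assms(1) S(2) by (intro finite_UN_I finite_cartesian_product finite_lists_length_eq) auto
    ultimately have "finite (?graph S)" by (rule finite_subset)
    moreover have "?graph S \<subseteq> L \<times> lists X"
      using S(1,3) unfolding is_struc_def by (fastforce simp: in_lists_conv_set)
    ultimately show ?thesis unfolding Fpow_def by blast
  qed
  then have "(\<lambda>S. (carr S, ?graph S)) ` ?\<S> \<subseteq> Fpow X \<times> Fpow (L \<times> lists X)"
    by (auto simp: Fpow_def)
  moreover have "countable (Fpow X \<times> Fpow (L \<times> lists X))"
    using assms by (simp add: countable_Fpow countable_finite countable_lists)
  ultimately show "countable ((\<lambda>S. (carr S, ?graph S)) ` ?\<S>)" by (rule countable_subset)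
  show "inj_on (\<lambda>S. (carr S, ?graph S)) ?\<S>"
    by (rule inj_onI, rule struc.equality) (auto simp: fun_eq_iff set_eq_iff)
qed

definition embeds_over :: "'r set \<Rightarrow> ('r \<Rightarrow> nat) \<Rightarrow> ('a, 'r) struc
    \<Rightarrow> 'a set \<Rightarrow> 'a set \<Rightarrow> 'a set \<Rightarrow> bool" where
  "embeds_over L ar S C F G \<longleftrightarrow>
     (\<exists>g. embedding L ar (induced S F) (induced S G) g \<and> (\<forall>u\<in>F \<inter> C. g u = u))"

text \<open>The image of \<open>induced S F\<close> under \<open>label_over C F\<close> codes the isomorphism type of \<open>F\<close> over \<open>C\<close>.\<close>

definition label_over :: "'a set \<Rightarrow> 'a set \<Rightarrow> 'a \<Rightarrow> 'a + nat" where
  "label_over C F u = (if u \<in> C then Inl u else Inr (to_nat_on F u))"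

lemma inj_on_label_over: "countable F \<Longrightarrow> inj_on (label_over C F) F"
  using inj_on_to_nat_on[of F] by (auto simp: label_over_def inj_on_def split: if_splits)

lemma label_over_eq_Inl_iff: "label_over C F u = Inl v \<longleftrightarrow> u = v \<and> v \<in> C"
  by (auto simp: label_over_def)

lemma image_struc_label_over_eq_imp_embeds_over:
  assumes types_eq: "image_struc (label_over C F) (induced S F)
      = image_struc (label_over C G) (induced S G)"
    and "countable F" "countable G"
  shows "embeds_over L ar S C F G"
proof -
  let ?g = "inv_into G (label_over C G) \<circ> label_over C F"
  have inj: "inj_on (label_over C F) F" "inj_on (label_over C G) G"
    using assms(2,3) by (simp_all add: inj_on_label_over)
  have "?g u = u" if u: "u \<in> F" "u \<in> C" for u
  proof -
    have "label_over C F u = Inl u" using u(2) by (simp add: label_over_def)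
    moreover have "label_over C F ` F = label_over C G ` G"
      using arg_cong[OF types_eq, of carr] by simp
    ultimately obtain v where "v \<in> G" "label_over C G v = Inl u" using u(1) by (metis imageE imageI)
    then have "u \<in> G" by (simp add: label_over_eq_Inl_iff)
    moreover have "label_over C F u = label_over C G u" using u(2) by (simp add: label_over_def)
    ultimately show ?thesis using inj(2) by simp
  qed
  moreover have "embedding L ar (induced S F) (induced S G) ?g"
    using image_struc_eq_imp_embedding[OF types_eq] inj by simp
  ultimately show ?thesis unfolding embeds_over_def by blast
qed

lemma ex_countable_representatives_over:
  assumes "finite L" "is_struc L ar S" "countable C"
  shows "\<exists>\<R>\<subseteq>Fpow (carr S). countable \<R> \<and> (\<forall>F\<in>Fpow (carr S). \<exists>G\<in>\<R>. embeds_over L ar S C F G)"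
proof -
  let ?type = "\<lambda>F. image_struc (label_over C F) (induced S F)"
  have "?type ` Fpow (carr S) \<subseteq> {T. is_struc L ar T \<and> finite (carr T) \<and> carr T \<subseteq> C <+> UNIV}"
    using assms(2) by (auto simp: Fpow_def label_over_def is_struc_image_struc is_struc_induced)
  then have countable_types: "countable (?type ` Fpow (carr S))"
    by (rule countable_subset) (intro countable_finite_strucs assms countable_Plus, simp)
  obtain \<R> where \<R>: "\<R> \<subseteq> Fpow (carr S)" "inj_on ?type \<R>" "?type ` Fpow (carr S) = ?type ` \<R>"
    using subset_image_inj[of "?type ` Fpow (carr S)" ?type "Fpow (carr S)"] by blast
  have "\<exists>G\<in>\<R>. embeds_over L ar S C F G" if F: "F \<in> Fpow (carr S)" for F
  proof -
    obtain G where "G \<in> \<R>" "?type F = ?type G" using \<R>(3) F by blast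
    moreover from this have "countable F" "countable G"
      using F \<R>(1) by (auto simp: Fpow_def intro: countable_finite)
    ultimately show ?thesis by (blast intro: image_struc_label_over_eq_imp_embeds_over)
  qed
  moreover have "countable \<R>" using countable_image_inj_on[OF _ \<R>(2)] countable_types \<R>(3) by simp
  ultimately show ?thesis using \<R>(1) by blast
qed

section \<open>Transfinite extension of partial maps\<close>

lemma well_order_on_finite_greatest:
  assumes "well_order_on X r" "G \<in> Fpow X" "G \<noteq> {}"
  shows "\<exists>b\<in>G. G \<subseteq> insert b (underS r b)"
proof -
  have order: "trans r" "antisym r" "total_on X r"
    using assms(1)
    unfolding well_order_on_def linear_order_on_def partial_order_on_def preorder_on_def by auto
  have G: "finite G" "G \<subseteq> X" using assms(2) by (auto simp: Fpow_def)
  have "asymp_on G (\<lambda>x y. (x, y) \<in> r \<and> x \<noteq> y)"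
    using order(2) by (auto intro!: asymp_onI dest: antisymD)
  moreover have "transp_on G (\<lambda>x y. (x, y) \<in> r \<and> x \<noteq> y)"
    using order(1,2) by (intro transp_onI) (meson antisymD transD)
  ultimately obtain b where b: "b \<in> G" "\<And>x. x \<in> G \<Longrightarrow> x \<noteq> b \<Longrightarrow> (b, x) \<notin> r"
    using Finite_Set.bex_max_element[OF G(1) _ _ assms(3)] by blast
  then have "x \<in> insert b (underS r b)" if "x \<in> G" for x
    using that order(3) G(2) unfolding total_on_def underS_def by blast
  then show ?thesis using b(1) by blast
qed

lemma finite_character_initial_segments:
  assumes wo: "well_order_on X r" and "C \<subseteq> X"
    and finite_character: "\<And>C. P C \<longleftrightarrow> (\<forall>G\<in>Fpow C. P G)"
    and "P {}" and segments: "\<And>b. b \<in> C \<Longrightarrow> P (insert b (underS r b))"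
  shows "P C"
proof (rule finite_character[THEN iffD2], rule ballI)
  fix G assume G: "G \<in> Fpow C"
  show "P G"
  proof (cases "G = {}")
    case True
    then show ?thesis using \<open>P {}\<close> by simp
  next
    case False
    have "G \<in> Fpow X" using G \<open>C \<subseteq> X\<close> Fpow_mono by blast
    then obtain b where b: "b \<in> G" "G \<subseteq> insert b (underS r b)"
      using well_order_on_finite_greatest[OF wo _ False] by blast
    have "P (insert b (underS r b))" using segments b(1) G by (auto simp: Fpow_def)
    moreover have "G \<in> Fpow (insert b (underS r b))" using b(2) G by (simp add: Fpow_def)
    ultimately show ?thesis using finite_character by blast
  qed
qed

lemma transfinite_extension:
  assumes wo: "well_order_on X r"
    and cong: "\<And>C f g. Q C f \<Longrightarrow> (\<And>u. u \<in> C \<Longrightarrow> f u = g u) \<Longrightarrow> Q C g"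
    and finite_character: "\<And>C f. Q C f \<longleftrightarrow> (\<forall>G\<in>Fpow C. Q G f)"
    and empty: "Q {} f\<^sub>0"
    and step: "\<And>a f. a \<in> X \<Longrightarrow> Q (underS r a) f \<Longrightarrow> \<exists>x. Q (insert a (underS r a)) (f(a := x))"
  shows "\<exists>f. Q X f"
proof -
  have wf: "wf (r - Id)" and "linear_order_on X r"
    using wo unfolding well_order_on_def by blast+
  then have underS_subset: "underS r a \<subseteq> X" for a
    by (auto simp: underS_def linear_order_on_def partial_order_on_def preorder_on_def refl_on_def)
  have limit: "Q C f" if "C \<subseteq> X" "\<And>b. b \<in> C \<Longrightarrow> Q (insert b (underS r b)) f" for C f
    by (rule finite_character_initial_segments[OF wo that(1) finite_character _ that(2)])
      (rule cong[OF empty], simp)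
  have "\<exists>f. \<forall>a. a \<in> X \<longrightarrow> Q (insert a (underS r a)) (f(a := f a))"
  proof (rule dependent_wf_choice[OF wf])
    fix f g :: "'a \<Rightarrow> 'b" and a x
    assume "\<And>b. (b, a) \<in> r - Id \<Longrightarrow> f b = g b"
    then have "(f(a := x)) u = (g(a := x)) u" if "u \<in> insert a (underS r a)" for u
      using that by (auto simp: underS_def)
    then show "(a \<in> X \<longrightarrow> Q (insert a (underS r a)) (f(a := x))) =
        (a \<in> X \<longrightarrow> Q (insert a (underS r a)) (g(a := x)))"
      using cong[of "insert a (underS r a)"] by metis
  next
    fix a f assume "\<And>b. (b, a) \<in> r - Id \<Longrightarrow> b \<in> X \<longrightarrow> Q (insert b (underS r b)) (f(b := f b))"
    then have "Q (insert b (underS r b)) f" if "b \<in> underS r a" for b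
      using that underS_subset by (auto simp: underS_def)
    then have "Q (underS r a) f" by (rule limit[OF underS_subset])
    then show "\<exists>x. a \<in> X \<longrightarrow> Q (insert a (underS r a)) (f(a := x))" using step by blast
  qed
  then show ?thesis using limit[of X] by auto
qed

lemma card_le_aleph1_imp_countable_underS:
  assumes "card_le_aleph1 X" "a \<in> X"
  shows "countable (underS (card_of X) a)"
proof -
  have "(card_of (underS (card_of X) a), card_of X) \<in> ordLess"
    using card_of_underS[OF card_of_Card_order[of X], of a] assms(2) by (simp add: Field_card_of)
  then have "(card_of (underS (card_of X) a), cardSuc natLeq) \<in> ordLess"
    using assms(1) unfolding card_le_aleph1_def by (rule ordLess_ordLeq_trans)
  then show ?thesis
    using cardSuc_ordLeq_ordLess[OF natLeq_Card_order card_of_Card_order]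
    unfolding countable_card_le_natLeq by blast
qed

section \<open>Coherent choices along a filter\<close>

text \<open>
  The function \<open>h'\<close> below may differ from \<open>h \<circ> g\<close> outside \<open>F\<close>: with \<open>g = id\<close>, the condition also says
  that \<open>E t\<close> is closed under restriction and depends only on the values on \<open>F\<close>.
\<close>

locale embedding_sieve =
  fixes L :: "'r set" and ar :: "'r \<Rightarrow> nat" and N :: "('n, 'r) struc"
    and E :: "nat \<Rightarrow> 'n set \<Rightarrow> ('n \<Rightarrow> 'm) \<Rightarrow> bool"
  assumes pullback: "\<And>t F G g h h'. E t G h \<Longrightarrow> embedding L ar (induced N F) (induced N G) g \<Longrightarrow>
    (\<And>u. u \<in> F \<Longrightarrow> h' u = h (g u)) \<Longrightarrow> E t F h'"
begin

definition extendible :: "nat \<Rightarrow> 'n set \<Rightarrow> 'n set \<Rightarrow> ('n \<Rightarrow> 'm) \<Rightarrow> bool" where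
  "extendible t F C v \<longleftrightarrow> (\<exists>h. E t F h \<and> (\<forall>u\<in>F \<inter> C. h u = v u))"

lemma extendible_if_embeds_over:
  assumes "extendible t G C v" "embeds_over L ar N C F G"
  shows "extendible t F C v"
proof -
  obtain h where h: "E t G h" "\<And>u. u \<in> G \<inter> C \<Longrightarrow> h u = v u"
    using assms(1) unfolding extendible_def by blast
  obtain g where g: "embedding L ar (induced N F) (induced N G) g" "\<And>u. u \<in> F \<inter> C \<Longrightarrow> g u = u"
    using assms(2) unfolding embeds_over_def by blast
  have "E t F (h \<circ> g)" using h(1) g(1) by (rule pullback) simp
  moreover have "(h \<circ> g) u = v u" if "u \<in> F \<inter> C" for u
  proof -
    have "g u \<in> G" using g(1) that unfolding embedding_def by auto
    then show ?thesis using h(2)[of u] g(2)[OF that] that by simp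
  qed
  ultimately show ?thesis unfolding extendible_def by blast
qed

lemma extendible_subset:
  assumes "extendible t G C v" "F \<subseteq> G"
  shows "extendible t F C v"
proof -
  have "embeds_over L ar N C F G"
    unfolding embeds_over_def using embedding_induced_mono[OF assms(2)] by fastforce
  with assms(1) show ?thesis by (rule extendible_if_embeds_over)
qed

lemma extendible_insert:
  assumes "extendible t F C v" "a \<notin> C"
  shows "\<exists>x. extendible t F (insert a C) (v(a := x))"
proof -
  obtain h where "E t F h" "\<forall>u\<in>F \<inter> C. h u = v u" using assms(1) unfolding extendible_def by blast
  then have "extendible t F (insert a C) (v(a := h a))"
    using assms(2) unfolding extendible_def by auto
  then show ?thesis ..
qed

lemma extendible_full:
  assumes "extendible t F C v" "F \<subseteq> C"
  shows "E t F v"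
proof -
  obtain h where "E t F h" "\<And>u. u \<in> F \<Longrightarrow> v u = h u"
    using assms unfolding extendible_def by (metis IntI subsetD)
  then show ?thesis using pullback[OF _ embedding_induced_mono[OF order.refl]] by simp
qed

definition extendible_along :: "nat filter \<Rightarrow> 'n set \<Rightarrow> ('n \<Rightarrow> nat \<Rightarrow> 'm) \<Rightarrow> bool" where
  "extendible_along U C f \<longleftrightarrow> (\<forall>F\<in>Fpow (carr N). \<forall>\<^sub>F t in U. extendible t F C (\<lambda>u. f u t))"

lemma extendible_along_cong:
  assumes "extendible_along U C f" "\<And>u. u \<in> C \<Longrightarrow> f u = g u"
  shows "extendible_along U C g"
  using assms unfolding extendible_along_def extendible_def by simp

lemma extendible_along_finite_character:
  "extendible_along U C f \<longleftrightarrow> (\<forall>G\<in>Fpow C. extendible_along U G f)"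
proof (intro iffI ballI)
  fix G assume "extendible_along U C f" "G \<in> Fpow C"
  then show "extendible_along U G f"
    unfolding extendible_along_def extendible_def
    by (fastforce simp: Fpow_def elim: eventually_mono)
next
  assume fin: "\<forall>G\<in>Fpow C. extendible_along U G f"
  show "extendible_along U C f"
    unfolding extendible_along_def
  proof
    fix F assume F: "F \<in> Fpow (carr N)"
    then have "F \<inter> C \<in> Fpow C" by (simp add: Fpow_def)
    then have "\<forall>\<^sub>F t in U. extendible t F (F \<inter> C) (\<lambda>u. f u t)"
      using fin F unfolding extendible_along_def by blast
    then show "\<forall>\<^sub>F t in U. extendible t F C (\<lambda>u. f u t)" by (simp add: extendible_def)
  qed
qed

lemma extendible_along_insert:
  assumes "finite L" "is_struc L ar N" "U \<le> sequentially" "countable C" "a \<notin> C"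
    and along_C: "extendible_along U C f"
  shows "\<exists>x. extendible_along U (insert a C) (f(a := x))"
proof -
  obtain \<R> where \<R>: "\<R> \<subseteq> Fpow (carr N)" "countable \<R>"
    and representative: "\<And>F. F \<in> Fpow (carr N) \<Longrightarrow> \<exists>G\<in>\<R>. embeds_over L ar N (insert a C) F G"
    using ex_countable_representatives_over[OF assms(1,2) countable_insert[OF assms(4)]] by metis
  have "\<exists>x. \<forall>G\<in>\<R>. \<forall>\<^sub>F t in U. extendible t G (insert a C) ((\<lambda>u. f u t)(a := x t))"
  proof (rule countable_saturation[OF assms(3) \<R>(2)])
    fix J assume "J \<in> Fpow \<R>"
    then have "\<Union>J \<in> Fpow (carr N)" using \<R>(1) by (fastforce simp: Fpow_def)
    then have "\<forall>\<^sub>F t in U. extendible t (\<Union>J) C (\<lambda>u. f u t)"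
      using along_C unfolding extendible_along_def by blast
    then show "\<forall>\<^sub>F t in U. \<exists>x. \<forall>G\<in>J. extendible t G (insert a C) ((\<lambda>u. f u t)(a := x))"
      by (rule eventually_mono) (meson assms(5) Union_upper extendible_insert extendible_subset)
  qed
  then obtain x where
    realised: "\<And>G. G \<in> \<R> \<Longrightarrow> \<forall>\<^sub>F t in U. extendible t G (insert a C) ((\<lambda>u. f u t)(a := x t))" by blast
  have "\<forall>\<^sub>F t in U. extendible t F (insert a C) (\<lambda>u. (f(a := x)) u t)"
    if "F \<in> Fpow (carr N)" for F
  proof -
    have "\<forall>\<^sub>F t in U. extendible t F (insert a C) ((\<lambda>u. f u t)(a := x t))"
      using realised representative[OF that] by (blast intro: eventually_mono extendible_if_embeds_over)
    moreover have "(\<lambda>u. f u t)(a := x t) = (\<lambda>u. (f(a := x)) u t)" for t by auto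
    ultimately show ?thesis by simp
  qed
  then show ?thesis unfolding extendible_along_def by blast
qed

lemma ex_coherent_choice:
  assumes "finite L" "is_struc L ar N" "U \<le> sequentially" "card_le_aleph1 (carr N)"
    and ex: "\<And>F. F \<in> Fpow (carr N) \<Longrightarrow> \<forall>\<^sub>F t in U. \<exists>h. E t F h"
  shows "\<exists>f. \<forall>F\<in>Fpow (carr N). \<forall>\<^sub>F t in U. E t F (\<lambda>u. f u t)"
proof -
  have "\<exists>f. extendible_along U (carr N) f"
  proof (rule transfinite_extension[OF card_of_well_order_on])
    show "extendible_along U {} f" for f
      using ex by (simp add: extendible_along_def extendible_def)
    fix a f assume "a \<in> carr N" "extendible_along U (underS (card_of (carr N)) a) f"
    then show "\<exists>x. extendible_along U (insert a (underS (card_of (carr N)) a)) (f(a := x))"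
      using card_le_aleph1_imp_countable_underS[OF assms(4)]
      by (intro extendible_along_insert[OF assms(1-3)]) (auto simp: underS_def)
  qed (fact extendible_along_cong extendible_along_finite_character)+
  then obtain f where total: "extendible_along U (carr N) f" ..
  have "\<forall>\<^sub>F t in U. E t F (\<lambda>u. f u t)" if F: "F \<in> Fpow (carr N)" for F
  proof -
    have "\<forall>\<^sub>F t in U. extendible t F (carr N) (\<lambda>u. f u t)"
      using total F unfolding extendible_along_def by blast
    then show ?thesis
      by (rule eventually_mono) (use F in \<open>auto simp: Fpow_def intro: extendible_full\<close>)
  qed
  then show ?thesis by blast
qed

end

section \<open>Embeddings with restricted colours\<close>

definition coloured_embedding :: "'r set \<Rightarrow> ('r \<Rightarrow> nat) \<Rightarrow> ('a, 'r) struc \<Rightarrow> ('p, 'r) struc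
    \<Rightarrow> ('m, 'r) struc \<Rightarrow> ('m set \<Rightarrow> 'c) \<Rightarrow> 'c set \<Rightarrow> ('p \<Rightarrow> 'm) \<Rightarrow> bool" where
  "coloured_embedding L ar A P T c S h \<longleftrightarrow>
     embedding L ar P T h \<and> (\<forall>X\<in>copies L ar P A. c (h ` X) \<in> S)"

lemma coloured_embedding_precomp:
  assumes coloured: "coloured_embedding L ar A P T c S h" and emb: "embedding L ar Q P g"
  shows "coloured_embedding L ar A Q T c S (h \<circ> g)"
proof -
  have "c ((h \<circ> g) ` X) \<in> S" if X: "X \<in> copies L ar Q A" for X
  proof -
    have "g ` X \<in> copies L ar P A"
      using image_in_copies_iff[OF emb in_copies_imp_subset[OF X]] X by blast
    then show ?thesis using coloured unfolding coloured_embedding_def image_comp[symmetric] by blast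
  qed
  then show ?thesis using coloured emb unfolding coloured_embedding_def by (blast intro: embedding_comp)
qed

lemma coloured_embedding_postcomp:
  assumes "coloured_embedding L ar A P C (\<lambda>X. c (e ` X)) S h" "embedding L ar C T e"
  shows "coloured_embedding L ar A P T c S (e \<circ> h)"
  using assms unfolding coloured_embedding_def image_comp[symmetric] by (blast intro: embedding_comp)

lemma coloured_embedding_cong:
  assumes coloured: "coloured_embedding L ar A P T c S h" and eq: "\<And>x. x \<in> carr P \<Longrightarrow> h x = h' x"
  shows "coloured_embedding L ar A P T c S h'"
proof -
  have "h' ` X = h ` X" if "X \<in> copies L ar P A" for X
    using that eq by (intro image_cong) (auto simp: copies_def)
  moreover have "embedding L ar P T h'"
    using coloured eq unfolding coloured_embedding_def by (blast intro: embedding_cong)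
  ultimately show ?thesis using coloured unfolding coloured_embedding_def by simp
qed

lemma embedding_sieve_coloured_embedding:
  "embedding_sieve L ar N (\<lambda>t F. coloured_embedding L ar A (induced N F) (M t) (c t) S)"
proof
  fix t F G g h h'
  assume "coloured_embedding L ar A (induced N G) (M t) (c t) S h"
    and "embedding L ar (induced N F) (induced N G) g" and eq: "\<And>u. u \<in> F \<Longrightarrow> h' u = h (g u)"
  then have "coloured_embedding L ar A (induced N F) (M t) (c t) S (h \<circ> g)"
    by (intro coloured_embedding_precomp)
  then show "coloured_embedding L ar A (induced N F) (M t) (c t) S h'"
    by (rule coloured_embedding_cong) (simp add: eq)
qed

definition colour_sets :: "nat \<Rightarrow> nat \<Rightarrow> nat set set" where
  "colour_sets k d = {S. S \<subseteq> {..<k} \<and> card S \<le> d}"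

lemma finite_colour_sets: "finite (colour_sets k d)"
  by (rule finite_subset[of _ "Pow {..<k}"]) (auto simp: colour_sets_def)

lemma arrow_imp_coloured_embedding:
  assumes "arrow L ar C B A k d" and bounded: "\<And>X. X \<in> copies L ar C A \<Longrightarrow> c X < k"
  shows "\<exists>S\<in>colour_sets k d. \<exists>h. coloured_embedding L ar A B C c S h"
proof -
  obtain Y where Y: "Y \<in> copies L ar C B"
    and few: "card (c ` copies L ar (induced C Y) A) \<le> d"
    using assms unfolding arrow_def by blast
  have subset: "Y \<subseteq> carr C" and "isomorphic L ar B (induced C Y)"
    using Y unfolding copies_def by (auto intro: isomorphic_sym)
  then obtain h where iso: "embedding L ar B (induced C Y) h" "h ` carr B = Y"
    unfolding isomorphic_iff_embedding by auto
  have emb: "embedding L ar B C h"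
    using embedding_comp[OF iso(1) embedding_inclusion[OF subset]] by simp
  let ?S = "c ` copies L ar (induced C Y) A"
  have "?S = (\<lambda>X. c (h ` X)) ` copies L ar B A"
    using copies_induced_embedding_image[OF emb, of A] iso(2) by (simp add: image_image)
  then have "coloured_embedding L ar A B C c ?S h"
    using emb unfolding coloured_embedding_def by blast
  moreover have "?S \<subseteq> {..<k}" using bounded unfolding copies_induced[OF subset] by auto
  ultimately show ?thesis using few unfolding colour_sets_def by blast
qed

lemma ramsey_bound_imp_eventually_coloured_embedding:
  assumes ultra: "ultrafilter U" and "ramsey_bound L ar K A d" "B \<in> K"
    and emb: "\<And>C. C \<in> K \<Longrightarrow> \<forall>\<^sub>F t in U. embeds L ar C (M t)"
    and bounded: "\<forall>\<^sub>F t in U. \<forall>X\<in>copies L ar (M t) A. c t X < k"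
  shows "\<exists>S\<in>colour_sets k d. \<forall>\<^sub>F t in U. \<exists>h. coloured_embedding L ar A B (M t) (c t) S h"
proof (rule ultrafilter_eventually_bex_finite[OF ultra])
  obtain C where C: "C \<in> K" "arrow L ar C B A k d"
    using assms(2,3) unfolding ramsey_bound_def by blast
  show "\<forall>\<^sub>F t in U. \<exists>S\<in>colour_sets k d. \<exists>h. coloured_embedding L ar A B (M t) (c t) S h"
    using emb[OF C(1)] bounded
  proof eventually_elim
    case (elim t)
    then obtain e where e: "embedding L ar C (M t) e" unfolding embeds_def by blast
    then have "c t (e ` X) < k" if "X \<in> copies L ar C A" for X
      using elim(2) that image_in_copies_iff[OF e in_copies_imp_subset[OF that]] by blast
    then show ?case
      using arrow_imp_coloured_embedding[OF C(2), of "\<lambda>X. c t (e ` X)"]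
        coloured_embedding_postcomp[OF _ e] by blast
  qed
qed (rule finite_colour_sets)

lemma finite_ex_uniform_on_Fpow:
  assumes "finite \<S>" and ex: "\<And>F. F \<in> Fpow X \<Longrightarrow> \<exists>S\<in>\<S>. P S F"
    and antimono: "\<And>S F G. P S G \<Longrightarrow> F \<subseteq> G \<Longrightarrow> P S F"
  shows "\<exists>S\<in>\<S>. \<forall>F\<in>Fpow X. P S F"
proof (rule ccontr)
  assume "\<not> ?thesis"
  then obtain F where F: "\<And>S. S \<in> \<S> \<Longrightarrow> F S \<in> Fpow X \<and> \<not> P S (F S)" by metis
  then have "(\<Union>S\<in>\<S>. F S) \<in> Fpow X" using \<open>finite \<S>\<close> by (auto simp: Fpow_def)
  then obtain S where "S \<in> \<S>" "P S (\<Union>S\<in>\<S>. F S)" using ex by blast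
  then show False using F antimono[of S _ "F S"] by blast
qed

lemma ex_uniform_colours:
  assumes ultra: "ultrafilter U" and struc: "is_struc L ar N"
    and bound: "ramsey_bound L ar (age L ar N) A d"
    and emb: "\<And>C. C \<in> age L ar N \<Longrightarrow> \<forall>\<^sub>F t in U. embeds L ar C (M t)"
    and bounded: "\<forall>\<^sub>F t in U. \<forall>X\<in>copies L ar (M t) A. c t X < k"
  shows "\<exists>S\<in>colour_sets k d. \<forall>F\<in>Fpow (carr N).
    \<forall>\<^sub>F t in U. \<exists>h. coloured_embedding L ar A (induced N F) (M t) (c t) S h"
proof (rule finite_ex_uniform_on_Fpow)
  fix F assume "F \<in> Fpow (carr N)"
  then obtain B g where B: "B \<in> age L ar N" and emb_F: "embedding L ar (induced N F) B g"
    using age_contains_finite_substructures[OF struc] unfolding isomorphic_iff_embedding by metis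
  from ramsey_bound_imp_eventually_coloured_embedding[OF ultra bound B emb bounded]
  show "\<exists>S\<in>colour_sets k d.
      \<forall>\<^sub>F t in U. \<exists>h. coloured_embedding L ar A (induced N F) (M t) (c t) S h"
    by (blast intro: eventually_mono coloured_embedding_precomp[OF _ emb_F])
next
  fix S F G assume "\<forall>\<^sub>F t in U. \<exists>h. coloured_embedding L ar A (induced N G) (M t) (c t) S h" "F \<subseteq> G"
  then show "\<forall>\<^sub>F t in U. \<exists>h. coloured_embedding L ar A (induced N F) (M t) (c t) S h"
    by (blast intro: eventually_mono coloured_embedding_precomp embedding_induced_mono)
qed (rule finite_colour_sets)

section \<open>The ultraproduct\<close>

lemma uclass_refl: "ultrafilter_on_nat D \<Longrightarrow> f \<in> uclass D f"
  by (simp add: uclass_def ultrafilter_on_nat_def)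

lemma uclass_eq_iff:
  assumes ultra: "ultrafilter_on_nat D"
  shows "uclass D f = uclass D g \<longleftrightarrow> (\<forall>\<^sub>F t in filter_of D. f t = g t)"
proof
  assume "uclass D f = uclass D g"
  then have "f \<in> uclass D g" using uclass_refl[OF ultra, of f] by simp
  then show "\<forall>\<^sub>F t in filter_of D. f t = g t"
    by (simp add: uclass_def eventually_filter_of[OF ultra])
next
  assume "\<forall>\<^sub>F t in filter_of D. f t = g t"
  then have "(\<forall>\<^sub>F t in filter_of D. h t = f t) \<longleftrightarrow> (\<forall>\<^sub>F t in filter_of D. h t = g t)" for h
    by (intro eventually_subst) (auto elim: eventually_mono)
  then show "uclass D f = uclass D g"
    unfolding uclass_def eventually_filter_of[OF ultra] by simp
qed

lemma eventually_rep_uclass: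
  assumes ultra: "ultrafilter_on_nat D"
  shows "\<forall>\<^sub>F t in filter_of D. rep (uclass D f) t = f t"
proof -
  have "rep (uclass D f) \<in> uclass D f"
    unfolding rep_def by (rule someI[of _ f]) (rule uclass_refl[OF ultra])
  then show ?thesis by (simp add: uclass_def eventually_filter_of[OF ultra])
qed

lemma uclass_in_carr_ultraproduct:
  assumes ultra: "ultrafilter_on_nat D" and "\<forall>\<^sub>F t in filter_of D. f t \<in> carr (M t)"
  shows "uclass D f \<in> carr (ultraproduct D M)"
  using assms(2) unfolding ultraproduct_def Let_def eventually_filter_of[OF ultra] by auto

lemma rels_ultraproduct_uclass_iff:
  assumes ultra: "ultrafilter_on_nat D"
    and carr: "\<And>u. u \<in> set us \<Longrightarrow> uclass D (f u) \<in> carr (ultraproduct D M)"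
  shows "rels (ultraproduct D M) R (map (\<lambda>u. uclass D (f u)) us) \<longleftrightarrow>
    (\<forall>\<^sub>F t in filter_of D. rels (M t) R (map (\<lambda>u. f u t) us))"
proof -
  have "\<forall>\<^sub>F t in filter_of D. \<forall>u\<in>set us. rep (uclass D (f u)) t = f u t"
    by (simp add: eventually_ball_finite eventually_rep_uclass[OF ultra])
  then have rep: "\<forall>\<^sub>F t in filter_of D.
      rels (M t) R (map (\<lambda>u. rep (uclass D (f u)) t) us) \<longleftrightarrow> rels (M t) R (map (\<lambda>u. f u t) us)"
    by (rule eventually_mono) (simp cong: map_cong)
  have "rels (ultraproduct D M) R (map (\<lambda>u. uclass D (f u)) us) \<longleftrightarrow>
      (\<forall>\<^sub>F t in filter_of D. rels (M t) R (map (\<lambda>u. rep (uclass D (f u)) t) us))"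
    using carr unfolding eventually_filter_of[OF ultra] ultraproduct_def Let_def by (auto simp: comp_def)
  also have "\<dots> \<longleftrightarrow> (\<forall>\<^sub>F t in filter_of D. rels (M t) R (map (\<lambda>u. f u t) us))"
    using rep by (rule eventually_subst)
  finally show ?thesis .
qed

lemma embedding_ultraproduct:
  assumes ultra: "ultrafilter_on_nat D"
    and emb: "\<And>F. F \<in> Fpow (carr N) \<Longrightarrow>
      \<forall>\<^sub>F t in filter_of D. embedding L ar (induced N F) (M t) (\<lambda>u. f u t)"
  shows "embedding L ar N (ultraproduct D M) (\<lambda>u. uclass D (f u))"
proof -
  have proper: "filter_of D \<noteq> bot" using ultrafilter_filter_of[OF ultra] by (simp add: ultrafilter_def)
  have carr: "uclass D (f u) \<in> carr (ultraproduct D M)" if "u \<in> carr N" for u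
  proof (rule uclass_in_carr_ultraproduct[OF ultra])
    have "{u} \<in> Fpow (carr N)" using that by (simp add: Fpow_def)
    from emb[OF this] show "\<forall>\<^sub>F t in filter_of D. f u t \<in> carr (M t)"
      by (rule eventually_mono) (simp add: embedding_def)
  qed
  have "u = v" if "u \<in> carr N" "v \<in> carr N" "uclass D (f u) = uclass D (f v)" for u v
  proof -
    have "{u, v} \<in> Fpow (carr N)" using that by (simp add: Fpow_def)
    from emb[OF this] have "\<forall>\<^sub>F t in filter_of D. f u t = f v t \<longrightarrow> u = v"
      by (rule eventually_mono) (auto simp: embedding_def)
    moreover have "\<forall>\<^sub>F t in filter_of D. f u t = f v t" using that(3) by (simp add: uclass_eq_iff[OF ultra])
    ultimately have "\<forall>\<^sub>F t in filter_of D. u = v" by eventually_elim simp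
    then show "u = v" using proper by simp
  qed
  moreover have "rels N R us \<longleftrightarrow> rels (ultraproduct D M) R (map (\<lambda>u. uclass D (f u)) us)"
    if R: "R \<in> L" and us: "length us = ar R" "set us \<subseteq> carr N" for R us
  proof -
    have "set us \<in> Fpow (carr N)" using us(2) by (simp add: Fpow_def)
    from emb[OF this]
    have agree: "\<forall>\<^sub>F t in filter_of D. rels N R us \<longleftrightarrow> rels (M t) R (map (\<lambda>u. f u t) us)"
      by (rule eventually_mono) (use R us in \<open>simp add: embedding_def preserves_def\<close>)
    have "rels N R us \<longleftrightarrow> (\<forall>\<^sub>F t in filter_of D. rels N R us)" using proper by simp
    also have "\<dots> \<longleftrightarrow> (\<forall>\<^sub>F t in filter_of D. rels (M t) R (map (\<lambda>u. f u t) us))"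
      using agree by (rule eventually_subst)
    also have "\<dots> \<longleftrightarrow> rels (ultraproduct D M) R (map (\<lambda>u. uclass D (f u)) us)"
      using carr us(2) by (intro rels_ultraproduct_uclass_iff[OF ultra, symmetric]) auto
    finally show ?thesis .
  qed
  ultimately show ?thesis
    using carr unfolding embedding_def preserves_def inj_on_def by auto
qed

section \<open>Internal colourings\<close>

lemma eventually_slice_image_uclass:
  assumes ultra: "ultrafilter_on_nat D" and "finite F"
  shows "\<forall>\<^sub>F t in filter_of D. slice ((\<lambda>u. uclass D (f u)) ` F) t = (\<lambda>u. f u t) ` F"
proof -
  have "\<forall>\<^sub>F t in filter_of D. \<forall>u\<in>F. rep (uclass D (f u)) t = f u t"
    using \<open>finite F\<close> by (simp add: eventually_ball_finite eventually_rep_uclass[OF ultra])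
  then show ?thesis
    by (rule eventually_mono) (simp add: slice_def image_image)
qed

lemma internal_colouring_imp_ex_stage_colourings:
  assumes ultra: "ultrafilter_on_nat D" and "internal_colouring L ar D M A k c"
  shows "\<exists>ct. (\<forall>\<^sub>F t in filter_of D. \<forall>Y\<in>copies L ar (M t) A. ct t Y < k) \<and>
    (\<forall>X\<in>copies L ar (ultraproduct D M) A. \<forall>\<^sub>F t in filter_of D. ct t (slice X t) = c X)"
proof -
  obtain Z ct where Z: "Z \<in> D" and bounded: "\<forall>t\<in>Z. \<forall>Y\<in>copies L ar (M t) A. ct t Y < k"
    and c_eq: "\<forall>X\<in>copies L ar (ultraproduct D M) A. \<forall>j. c X = j \<longleftrightarrow>
      {t \<in> Z. isomorphic L ar (induced (M t) (slice X t)) (induced (ultraproduct D M) X)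
        \<and> ct t (slice X t) = j} \<in> D"
    using assms(2) unfolding internal_colouring_def Let_def by blast
  have "\<forall>\<^sub>F t in filter_of D. t \<in> Z" using Z by (simp add: eventually_filter_of[OF ultra])
  then have "\<forall>\<^sub>F t in filter_of D. \<forall>Y\<in>copies L ar (M t) A. ct t Y < k"
    by (rule eventually_mono) (use bounded in blast)
  moreover have "\<forall>\<^sub>F t in filter_of D. ct t (slice X t) = c X"
    if "X \<in> copies L ar (ultraproduct D M) A" for X
  proof -
    have "\<forall>\<^sub>F t in filter_of D. t \<in> Z
        \<and> isomorphic L ar (induced (M t) (slice X t)) (induced (ultraproduct D M) X)
        \<and> ct t (slice X t) = c X"
      using c_eq that unfolding eventually_filter_of[OF ultra] by blast
    then show ?thesis by (rule eventually_mono) blast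
  qed
  ultimately show ?thesis by blast
qed

lemma coherent_coloured_embeddings_imp_copy:
  assumes ultra: "ultrafilter_on_nat D" and "finite (carr A)"
    and stage_colours: "\<forall>X\<in>copies L ar (ultraproduct D M) A. \<forall>\<^sub>F t in filter_of D. ct t (slice X t) = c X"
    and coherent: "\<forall>F\<in>Fpow (carr N). \<forall>\<^sub>F t in filter_of D.
      coloured_embedding L ar A (induced N F) (M t) (ct t) S (\<lambda>u. f u t)"
  shows "\<exists>Y\<in>copies L ar (ultraproduct D M) N.
    c ` copies L ar (induced (ultraproduct D M) Y) A \<subseteq> S"
proof
  let ?\<phi> = "\<lambda>u. uclass D (f u)"
  have emb: "embedding L ar N (ultraproduct D M) ?\<phi>"
    using coherent by (intro embedding_ultraproduct[OF ultra])
      (auto simp: coloured_embedding_def elim: eventually_mono)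
  then show "?\<phi> ` carr N \<in> copies L ar (ultraproduct D M) N" by (rule embedding_image_in_copies)
  have "c (?\<phi> ` F) \<in> S" if F: "F \<in> copies L ar N A" for F
  proof -
    have "F \<subseteq> carr N" "finite F" using F in_copies_imp_finite[OF F assms(2)] by (auto simp: copies_def)
    then have "F \<in> Fpow (carr N)" and "F \<in> copies L ar (induced N F) A"
      and "?\<phi> ` F \<in> copies L ar (ultraproduct D M) A"
      using F image_in_copies_iff[OF emb] by (auto simp: Fpow_def copies_induced)
    then have "\<forall>\<^sub>F t in filter_of D. ct t ((\<lambda>u. f u t) ` F) \<in> S"
      and "\<forall>\<^sub>F t in filter_of D. ct t (slice (?\<phi> ` F) t) = c (?\<phi> ` F)"
      using coherent stage_colours unfolding coloured_embedding_def by (blast intro: eventually_mono)+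
    then have "\<forall>\<^sub>F t in filter_of D. c (?\<phi> ` F) \<in> S"
      using eventually_slice_image_uclass[OF ultra \<open>finite F\<close>, of f] by eventually_elim simp
    then show ?thesis using ultrafilter_filter_of[OF ultra] by (simp add: ultrafilter_def)
  qed
  then show "c ` copies L ar (induced (ultraproduct D M) (?\<phi> ` carr N)) A \<subseteq> S"
    unfolding copies_induced_embedding_image[OF emb] by blast
qed

lemma trending_imp_eventually_embeds:
  assumes ultra: "ultrafilter_on_nat D" and "trending L ar D M" and "C \<in> (\<Union>t. age L ar (M t))"
  shows "\<forall>\<^sub>F t in filter_of D. embeds L ar C (M t)"
proof -
  obtain i where "embeds L ar C (M i)" using assms(3) unfolding age_def by blast
  moreover have "\<forall>\<^sub>F t in filter_of D. embeds L ar (M i) (M t)"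
    using assms(2) unfolding trending_def eventually_filter_of[OF ultra] by blast
  ultimately show ?thesis
    unfolding embeds_def by (blast intro: eventually_mono embedding_comp)
qed

lemma ramsey_bound_small_ramsey_degree:
  assumes "finite_small_ramsey_degree L ar K A"
  shows "ramsey_bound L ar K A (small_ramsey_degree L ar K A)"
  using assms LeastI_ex unfolding finite_small_ramsey_degree_def small_ramsey_degree_def by metis

theorem mainTheorem5:
  fixes L :: "'r set" and ar :: "'r \<Rightarrow> nat"
    and D :: "nat set set"
    and M :: "nat \<Rightarrow> ('m, 'r) struc"
    and N :: "('n, 'r) struc"
    and A :: "(nat, 'r) struc"
  assumes "finite L"
    and "ultrafilter_on_nat D" and "nonprincipal D"
    and "\<forall>t. is_struc L ar (M t) \<and> finite (carr (M t))"
    and "trending L ar D M"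
    and "is_struc L ar N"
    and "card_le_aleph1 (carr N)"
    and "age L ar N \<subseteq> (\<Union>t. age L ar (M t))"
    and "A \<in> age L ar N"
    and "finite_small_ramsey_degree L ar (age L ar N) A"
  shows "\<forall>k. int_arrow L ar D M N A k (small_ramsey_degree L ar (age L ar N) A)"
  unfolding int_arrow_def
proof (intro allI impI)
  let ?d = "small_ramsey_degree L ar (age L ar N) A" and ?Ms = "ultraproduct D M"
  note ultra = assms(2)
  fix k c assume "internal_colouring L ar D M A k c"
  then obtain ct where bounded: "\<forall>\<^sub>F t in filter_of D. \<forall>Y\<in>copies L ar (M t) A. ct t Y < k"
    and stage_colours: "\<forall>X\<in>copies L ar ?Ms A. \<forall>\<^sub>F t in filter_of D. ct t (slice X t) = c X"
    using internal_colouring_imp_ex_stage_colourings[OF ultra] by blast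
  have "\<forall>\<^sub>F t in filter_of D. embeds L ar C (M t)" if "C \<in> age L ar N" for C
    using trending_imp_eventually_embeds[OF ultra assms(5)] that assms(8) by blast
  then obtain S where S: "S \<in> colour_sets k ?d" and often: "\<And>F. F \<in> Fpow (carr N) \<Longrightarrow>
      \<forall>\<^sub>F t in filter_of D. \<exists>h. coloured_embedding L ar A (induced N F) (M t) (ct t) S h"
    using ex_uniform_colours[OF ultrafilter_filter_of[OF ultra] assms(6)
        ramsey_bound_small_ramsey_degree[OF assms(10)] _ bounded] by blast
  obtain f where "\<forall>F\<in>Fpow (carr N). \<forall>\<^sub>F t in filter_of D.
      coloured_embedding L ar A (induced N F) (M t) (ct t) S (\<lambda>u. f u t)"
    using embedding_sieve.ex_coherent_choice[OF embedding_sieve_coloured_embedding assms(1,6)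
        filter_of_le_sequentially[OF assms(2,3)] assms(7) often] by blast
  with stage_colours obtain Y where "Y \<in> copies L ar ?Ms N" "c ` copies L ar (induced ?Ms Y) A \<subseteq> S"
    using coherent_coloured_embeddings_imp_copy[OF ultra] assms(9) unfolding age_def by blast
  then show "\<exists>Y\<in>copies L ar ?Ms N. card (c ` copies L ar (induced ?Ms Y) A) \<le> ?d"
    using S unfolding colour_sets_def
    by (blast intro: le_trans[OF card_mono] finite_subset[OF _ finite_lessThan])
qed

end
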